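(* Let $p$ be a prime, let $F$ be a complex valued function on the set of balls in $\mathbb{Q}_p$, and let $D_{F(\cdot)}$ be the operator $$ D_{F(\cdot)}f(x)=\int_{\mathbb{Q}_p} F({\rm sup}(x,y))\,(f(x)-f(y))\,dy . $$ Let $\phi:\mathbb{Q}_p\to\mathbb{Q}_p$ be a ball-morphism that is the product of the multiplication by $p^{\gamma}$, $\gamma\in\mathbb{Z}$, and an isometry of $\mathbb{Q}_p$, and let $\Phi f(x)=f(\phi(x))$. Then $$ \Phi\circ D_{F(\cdot)}=p^{-\gamma}\,D_{F(\phi(\cdot))}\circ\Phi , $$ that is, $(D_{F(\cdot)}f)(\phi(x))=p^{-\gamma}\bigl(D_{F(\phi(\cdot))}(\Phi f)\bigr)(x)$ for all $f:\mathbb{Q}_p\to\mathbb{C}$ and $x\in\mathbb{Q}_p$ for which the integrals defining both sides converge absolutely.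
   Context: A ball is a set $\{x\in\mathbb{Q}_p:|x-a|_p\le p^{k}\}$ with $a\in\mathbb{Q}_p$, $k\in\mathbb{Z}$. A ball-morphism of $\mathbb{Q}_p$ is a bijection $\mathbb{Q}_p\to\mathbb{Q}_p$ for which the image and the inverse image of any ball are balls. For $x\ne y$ in $\mathbb{Q}_p$, ${\rm sup}(x,y)$ is the minimal ball containing $x$ and $y$ (the set $y=x$ has measure zero and is ignored in the integral). $F(\phi(\cdot))$ denotes the function $I\mapsto F(\phi(I))$ on balls, where $\phi(I)$ is the image of the ball $I$. $dy$ is the Haar measure on $\mathbb{Q}_p$ normalized so that $\mathbb{Z}_p$ has measure one. $p^{-\gamma}$ on the right-hand side of the rule is a real number. *)

theory Defs
  imports "HOL-Analysis.Analysis" "Berlekamp_Zassenhaus.Finite_Field"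
begin

definition rat_padic_abs :: "nat \<Rightarrow> rat \<Rightarrow> real" where
  "rat_padic_abs p q = (if q = 0 then 0 else
     of_nat p powi (int (multiplicity (int p) (snd (quotient_of q)))
                  - int (multiplicity (int p) (fst (quotient_of q)))))"

definition padic_cauchy :: "nat \<Rightarrow> (nat \<Rightarrow> rat) \<Rightarrow> bool" where
  "padic_cauchy p X \<longleftrightarrow> (\<forall>e>0. \<exists>N. \<forall>m\<ge>N. \<forall>n\<ge>N. rat_padic_abs p (X m - X n) < e)"

definition padic_vanishes :: "nat \<Rightarrow> (nat \<Rightarrow> rat) \<Rightarrow> bool" where
  "padic_vanishes p X \<longleftrightarrow> (\<lambda>n. rat_padic_abs p (X n)) \<longlonglongrightarrow> 0"

definition padic_rel :: "nat \<Rightarrow> (nat \<Rightarrow> rat) \<Rightarrow> (nat \<Rightarrow> rat) \<Rightarrow> bool" where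
  "padic_rel p X Y \<longleftrightarrow> padic_cauchy p X \<and> padic_cauchy p Y \<and> padic_vanishes p (\<lambda>n. X n - Y n)"

context
  fixes p :: nat
  assumes p: "prime p"
begin

lemma rat_padic_abs_Fract:
  assumes "a \<noteq> 0" "b \<noteq> 0"
  shows "rat_padic_abs p (Rat.Fract a b) =
    of_nat p powi (int (multiplicity (int p) b) - int (multiplicity (int p) a))"
proof -
  obtain c d where cd: "quotient_of (Rat.Fract a b) = (c, d)" by force
  have d: "d > 0" using cd by (rule quotient_of_denom_pos)
  have "Rat.Fract a b = Rat.Fract c d"
    using quotient_of_div[OF cd] by (simp add: Fract_of_int_quotient)
  hence e: "a * d = c * b" using assms d by (simp add: eq_rat)
  have c: "c \<noteq> 0" using e assms d by auto
  have pr: "prime_elem (int p)" using p by simp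
  have "multiplicity (int p) a + multiplicity (int p) d
      = multiplicity (int p) c + multiplicity (int p) b"
    using arg_cong[OF e, of "multiplicity (int p)"] assms c d
    by (simp add: prime_elem_multiplicity_mult_distrib[OF pr])
  hence "int (multiplicity (int p) d) - int (multiplicity (int p) c)
      = int (multiplicity (int p) b) - int (multiplicity (int p) a)" by linarith
  moreover have "Rat.Fract a b \<noteq> 0" using assms by (simp add: Zero_rat_def eq_rat)
  ultimately show ?thesis by (simp add: rat_padic_abs_def cd)
qed

lemma rat_padic_abs_0 [simp]: "rat_padic_abs p 0 = 0"
  by (simp add: rat_padic_abs_def)

lemma rat_padic_abs_nonneg [simp]: "0 \<le> rat_padic_abs p q"
  by (simp add: rat_padic_abs_def)

lemma rat_padic_abs_pos: "q \<noteq> 0 \<Longrightarrow> 0 < rat_padic_abs p q"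
  using prime_gt_0_nat[OF p] by (simp add: rat_padic_abs_def)

lemma rat_padic_abs_eq_0 [simp]: "rat_padic_abs p q = 0 \<longleftrightarrow> q = 0"
  using rat_padic_abs_pos[of q] by fastforce

lemma rat_padic_abs_1 [simp]: "rat_padic_abs p 1 = 1"
  using rat_padic_abs_Fract[of 1 1] by (simp add: One_rat_def)

lemma rat_padic_abs_mult: "rat_padic_abs p (x * y) = rat_padic_abs p x * rat_padic_abs p y"
proof (cases "x = 0 \<or> y = 0")
  case False
  obtain a b where x: "x = Rat.Fract a b" "b > 0" using Rat_cases by metis
  obtain c d where y: "y = Rat.Fract c d" "d > 0" using Rat_cases by metis
  have nz: "a \<noteq> 0" "c \<noteq> 0" using False x y by (auto simp: rat_number_collapse)
  have pr: "prime_elem (int p)" using p by simp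
  have p0: "real p \<noteq> 0" using prime_gt_0_nat[OF p] by simp
  show ?thesis using nz x y p0
    by (simp add: rat_padic_abs_Fract prime_elem_multiplicity_mult_distrib[OF pr]
        flip: power_int_add) (simp add: algebra_simps)
qed auto

lemma rat_padic_abs_minus [simp]: "rat_padic_abs p (- x) = rat_padic_abs p x"
proof -
  have "rat_padic_abs p (-1) * rat_padic_abs p (-1) = 1"
    using rat_padic_abs_mult[of "-1" "-1"] by simp
  hence "rat_padic_abs p (-1) = 1"
    using rat_padic_abs_nonneg[of "-1"] by (simp add: square_eq_1_iff)
  thus ?thesis using rat_padic_abs_mult[of "-1" x] by simp
qed

lemma rat_padic_abs_diff_commute: "rat_padic_abs p (x - y) = rat_padic_abs p (y - x)"
  using rat_padic_abs_minus[of "x - y"] by simp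

lemma rat_padic_abs_inverse: "rat_padic_abs p (inverse x) = inverse (rat_padic_abs p x)"
proof (cases "x = 0")
  case False
  have "rat_padic_abs p x * rat_padic_abs p (inverse x) = 1"
    using False by (simp flip: rat_padic_abs_mult)
  thus ?thesis by (metis inverse_unique)
qed simp

lemma rat_padic_abs_add: "rat_padic_abs p (x + y) \<le> max (rat_padic_abs p x) (rat_padic_abs p y)"
proof (cases "x = 0 \<or> y = 0 \<or> x + y = 0")
  case True
  thus ?thesis by (auto simp: le_max_iff_disj)
next
  case False
  obtain a b where x: "x = Rat.Fract a b" "b > 0" using Rat_cases by metis
  obtain c d where y: "y = Rat.Fract c d" "d > 0" using Rat_cases by metis
  have xy: "x + y = Rat.Fract (a * d + c * b) (b * d)" using x y by simp
  have nz: "a \<noteq> 0" "c \<noteq> 0" "a * d + c * b \<noteq> 0"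
    using False x y xy by (auto simp: rat_number_collapse)
  let ?m = "multiplicity (int p)"
  have pr: "prime_elem (int p)" using p by simp
  have nu: "\<not> is_unit (int p)" using pr by (rule prime_elem_not_unit)
  have p1: "real p \<ge> 1" using prime_ge_1_nat[OF p] by simp
  let ?k = "min (?m (a * d)) (?m (c * b))"
  have "int p ^ ?k dvd a * d" "int p ^ ?k dvd c * b"
    by (auto intro: multiplicity_dvd')
  hence "int p ^ ?k dvd a * d + c * b" by (rule dvd_add)
  hence "?k \<le> ?m (a * d + c * b)" using nz(3) nu by (intro multiplicity_geI)
  hence k: "?m a + ?m d \<le> ?m (a * d + c * b) \<or> ?m c + ?m b \<le> ?m (a * d + c * b)"
    using nz x y by (simp add: prime_elem_multiplicity_mult_distrib[OF pr] min_le_iff_disj)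
  have "rat_padic_abs p (x + y) = real p powi (int (?m b + ?m d) - int (?m (a * d + c * b)))"
    unfolding xy using nz x y
    by (simp add: rat_padic_abs_Fract prime_elem_multiplicity_mult_distrib[OF pr])
  moreover have "rat_padic_abs p x = real p powi (int (?m b) - int (?m a))"
    using nz x by (simp add: rat_padic_abs_Fract)
  moreover have "rat_padic_abs p y = real p powi (int (?m d) - int (?m c))"
    using nz y by (simp add: rat_padic_abs_Fract)
  ultimately show ?thesis
    using k p1 by (auto simp: le_max_iff_disj intro!: power_int_increasing)
qed

lemma rat_padic_abs_triangle: "rat_padic_abs p (x + y) \<le> rat_padic_abs p x + rat_padic_abs p y"
  using rat_padic_abs_add[of x y] rat_padic_abs_nonneg[of x] rat_padic_abs_nonneg[of y] by linarith

lemma rat_padic_abs_triangle_rev: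
  "\<bar>rat_padic_abs p x - rat_padic_abs p y\<bar> \<le> rat_padic_abs p (x - y)"
  using rat_padic_abs_triangle[of "x - y" y] rat_padic_abs_triangle[of "y - x" x]
    rat_padic_abs_diff_commute[of x y] by simp

lemma padic_vanishes_le:
  assumes "Y \<longlonglongrightarrow> 0" "\<And>n. rat_padic_abs p (X n) \<le> Y n"
  shows "padic_vanishes p X"
  unfolding padic_vanishes_def
  by (rule tendsto_sandwich[OF _ _ tendsto_const assms(1)]) (use assms in auto)

lemma padic_vanishes_const [simp]: "padic_vanishes p (\<lambda>n. c) \<longleftrightarrow> c = 0"
  by (simp add: padic_vanishes_def LIMSEQ_const_iff)

lemma padic_vanishes_minus: "padic_vanishes p X \<Longrightarrow> padic_vanishes p (\<lambda>n. - X n)"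
  by (simp add: padic_vanishes_def)

lemma padic_vanishes_add:
  assumes "padic_vanishes p X" "padic_vanishes p Y"
  shows "padic_vanishes p (\<lambda>n. X n + Y n)"
  by (rule padic_vanishes_le[OF _ rat_padic_abs_triangle])
    (use tendsto_add[of _ 0 _ _ 0] assms in \<open>simp add: padic_vanishes_def\<close>)

lemma padic_cauchy_const [simp]: "padic_cauchy p (\<lambda>n. c)"
  by (simp add: padic_cauchy_def)

lemma padic_cauchy_minus: "padic_cauchy p X \<Longrightarrow> padic_cauchy p (\<lambda>n. - X n)"
  unfolding padic_cauchy_def using rat_padic_abs_diff_commute by simp

lemma padic_cauchy_add:
  assumes "padic_cauchy p X" "padic_cauchy p Y"
  shows "padic_cauchy p (\<lambda>n. X n + Y n)"
  unfolding padic_cauchy_def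
proof (intro allI impI)
  fix e :: real assume "e > 0"
  then obtain M N where "\<forall>m\<ge>M. \<forall>n\<ge>M. rat_padic_abs p (X m - X n) < e"
    "\<forall>m\<ge>N. \<forall>n\<ge>N. rat_padic_abs p (Y m - Y n) < e"
    using assms unfolding padic_cauchy_def by meson
  thus "\<exists>K. \<forall>m\<ge>K. \<forall>n\<ge>K. rat_padic_abs p (X m + Y m - (X n + Y n)) < e"
    by (intro exI[of _ "max M N"])
      (auto simp: add_diff_add intro: le_less_trans[OF rat_padic_abs_add])
qed

lemma padic_cauchy_Cauchy:
  assumes "padic_cauchy p X"
  shows "Cauchy (\<lambda>n. rat_padic_abs p (X n))"
  using assms unfolding padic_cauchy_def Cauchy_def dist_real_def
  by (meson le_less_trans rat_padic_abs_triangle_rev)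

lemma padic_cauchy_bounded:
  assumes "padic_cauchy p X"
  obtains B where "B > 0" "\<And>n. rat_padic_abs p (X n) \<le> B"
proof -
  have "Bseq (\<lambda>n. rat_padic_abs p (X n))"
    using padic_cauchy_Cauchy[OF assms] by (simp add: Cauchy_Bseq)
  thus ?thesis using that by (auto simp: Bseq_def)
qed

lemma padic_vanishes_mult_bounded:
  assumes "padic_cauchy p X" "padic_vanishes p Y"
  shows "padic_vanishes p (\<lambda>n. X n * Y n)"
proof -
  obtain B where B: "B > 0" "\<And>n. rat_padic_abs p (X n) \<le> B"
    using padic_cauchy_bounded[OF assms(1)] by blast
  have "(\<lambda>n. B * rat_padic_abs p (Y n)) \<longlonglongrightarrow> 0"
    using tendsto_mult_right_zero assms(2) unfolding padic_vanishes_def by blast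
  thus ?thesis
    by (rule padic_vanishes_le) (simp add: rat_padic_abs_mult mult_right_mono B)
qed

lemma padic_cauchy_mult:
  assumes "padic_cauchy p X" "padic_cauchy p Y"
  shows "padic_cauchy p (\<lambda>n. X n * Y n)"
  unfolding padic_cauchy_def
proof (intro allI impI)
  fix e :: real assume e: "e > 0"
  obtain B where B: "B > 0" "\<And>n. rat_padic_abs p (X n) \<le> B"
    using padic_cauchy_bounded[OF assms(1)] by blast
  obtain C where C: "C > 0" "\<And>n. rat_padic_abs p (Y n) \<le> C"
    using padic_cauchy_bounded[OF assms(2)] by blast
  obtain M N where M: "\<forall>m\<ge>M. \<forall>n\<ge>M. rat_padic_abs p (X m - X n) < e / C"
    and N: "\<forall>m\<ge>N. \<forall>n\<ge>N. rat_padic_abs p (Y m - Y n) < e / B"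
    using assms e B C unfolding padic_cauchy_def by (meson divide_pos_pos)
  have "rat_padic_abs p (X m * Y m - X n * Y n) < e" if "m \<ge> max M N" "n \<ge> max M N" for m n
  proof -
    have "rat_padic_abs p (X m * (Y m - Y n)) \<le> B * rat_padic_abs p (Y m - Y n)"
      by (simp add: rat_padic_abs_mult mult_right_mono B)
    also have "\<dots> < e" using N that B by (simp add: pos_less_divide_eq mult.commute)
    finally have 1: "rat_padic_abs p (X m * (Y m - Y n)) < e" .
    have "rat_padic_abs p ((X m - X n) * Y n) \<le> rat_padic_abs p (X m - X n) * C"
      by (simp add: rat_padic_abs_mult mult_left_mono C)
    also have "\<dots> < e" using M that C by (simp add: pos_less_divide_eq)
    finally have 2: "rat_padic_abs p ((X m - X n) * Y n) < e" .
    have "X m * Y m - X n * Y n = X m * (Y m - Y n) + (X m - X n) * Y n"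
      by (simp add: algebra_simps)
    thus ?thesis
      using le_less_trans[OF rat_padic_abs_add, of "X m * (Y m - Y n)" "(X m - X n) * Y n" e] 1 2
      by simp
  qed
  thus "\<exists>K. \<forall>m\<ge>K. \<forall>n\<ge>K. rat_padic_abs p (X m * Y m - X n * Y n) < e" by blast
qed

lemma padic_not_vanishes:
  assumes "padic_cauchy p X" "\<not> padic_vanishes p X"
  obtains b N where "b > 0" "\<And>n. n \<ge> N \<Longrightarrow> b < rat_padic_abs p (X n)"
proof -
  obtain L where L: "(\<lambda>n. rat_padic_abs p (X n)) \<longlonglongrightarrow> L"
    using padic_cauchy_Cauchy[OF assms(1)] by (auto simp: Cauchy_convergent_iff convergent_def)
  have "L \<ge> 0" by (rule LIMSEQ_le_const[OF L]) simp
  moreover have "L \<noteq> 0" using assms(2) L by (auto simp: padic_vanishes_def)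
  ultimately have "L > 0" by simp
  hence "\<forall>\<^sub>F n in sequentially. L / 2 < rat_padic_abs p (X n)"
    using order_tendstoD(1)[OF L, of "L / 2"] by simp
  thus ?thesis using \<open>L > 0\<close> that[of "L / 2"] by (auto simp: eventually_sequentially)
qed

lemma rat_padic_abs_inverse_diff:
  assumes "b > 0" "b < rat_padic_abs p x" "c > 0" "c < rat_padic_abs p y"
  shows "rat_padic_abs p (inverse x - inverse y) \<le> rat_padic_abs p (x - y) / (b * c)"
proof -
  have nz: "x \<noteq> 0" "y \<noteq> 0" using assms by auto
  have eq: "inverse x - inverse y = - (inverse x * (x - y) * inverse y)"
    using nz by (simp add: field_simps)
  have "rat_padic_abs p (inverse x - inverse y)
      = rat_padic_abs p (x - y) / (rat_padic_abs p x * rat_padic_abs p y)"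
    unfolding eq by (simp add: rat_padic_abs_mult rat_padic_abs_inverse divide_inverse)
  also have "\<dots> \<le> rat_padic_abs p (x - y) / (b * c)"
    using assms by (intro divide_left_mono mult_mono mult_pos_pos) auto
  finally show ?thesis .
qed

lemma padic_cauchy_inverse:
  assumes "padic_cauchy p X" "\<not> padic_vanishes p X"
  shows "padic_cauchy p (\<lambda>n. inverse (X n))"
  unfolding padic_cauchy_def
proof (intro allI impI)
  fix e :: real assume e: "e > 0"
  obtain b N where b: "b > 0" "\<And>n. n \<ge> N \<Longrightarrow> b < rat_padic_abs p (X n)"
    using padic_not_vanishes[OF assms] by blast
  obtain M where M: "\<forall>m\<ge>M. \<forall>n\<ge>M. rat_padic_abs p (X m - X n) < e * (b * b)"
    using assms(1) e b unfolding padic_cauchy_def by (meson mult_pos_pos)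
  have "rat_padic_abs p (inverse (X m) - inverse (X n)) < e" if "m \<ge> max M N" "n \<ge> max M N" for m n
  proof -
    have "rat_padic_abs p (inverse (X m) - inverse (X n)) \<le> rat_padic_abs p (X m - X n) / (b * b)"
      using that b by (intro rat_padic_abs_inverse_diff) auto
    also have "\<dots> < e" using M that b by (simp add: pos_divide_less_eq)
    finally show ?thesis .
  qed
  thus "\<exists>K. \<forall>m\<ge>K. \<forall>n\<ge>K. rat_padic_abs p (inverse (X m) - inverse (X n)) < e" by blast
qed

lemma padic_vanishes_cong:
  assumes "padic_vanishes p (\<lambda>n. X n - Y n)"
  shows "padic_vanishes p X \<longleftrightarrow> padic_vanishes p Y"
proof
  assume "padic_vanishes p X"
  from padic_vanishes_add[OF this padic_vanishes_minus[OF assms]]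
  show "padic_vanishes p Y" by simp
next
  assume "padic_vanishes p Y"
  from padic_vanishes_add[OF this assms] show "padic_vanishes p X" by simp
qed

lemma padic_vanishes_inverse_diff:
  assumes "padic_cauchy p X" "\<not> padic_vanishes p X" "padic_cauchy p Y" "\<not> padic_vanishes p Y"
    "padic_vanishes p (\<lambda>n. X n - Y n)"
  shows "padic_vanishes p (\<lambda>n. inverse (X n) - inverse (Y n))"
proof -
  obtain b N where b: "b > 0" "\<And>n. n \<ge> N \<Longrightarrow> b < rat_padic_abs p (X n)"
    using padic_not_vanishes[OF assms(1,2)] by blast
  obtain c M where c: "c > 0" "\<And>n. n \<ge> M \<Longrightarrow> c < rat_padic_abs p (Y n)"
    using padic_not_vanishes[OF assms(3,4)] by blast
  have 1: "(\<lambda>n. rat_padic_abs p (X n - Y n) / (b * c)) \<longlonglongrightarrow> 0"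
    using assms(5) unfolding padic_vanishes_def by (rule tendsto_divide_zero)
  have 2: "\<forall>\<^sub>F n in sequentially. rat_padic_abs p (inverse (X n) - inverse (Y n))
      \<le> rat_padic_abs p (X n - Y n) / (b * c)"
    using eventually_ge_at_top[of "max M N"]
    by eventually_elim (use b c in \<open>auto intro!: rat_padic_abs_inverse_diff\<close>)
  show ?thesis unfolding padic_vanishes_def
    by (rule tendsto_sandwich[OF _ 2 tendsto_const 1]) simp
qed

lemma padic_rel_refl: "padic_cauchy p X \<Longrightarrow> padic_rel p X X"
  by (simp add: padic_rel_def)

lemma part_equivp_padic_rel: "part_equivp (padic_rel p)"
proof (rule part_equivpI)
  show "\<exists>X. padic_rel p X X" using padic_rel_refl padic_cauchy_const by blast
  show "symp (padic_rel p)"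
    by (rule sympI) (simp add: padic_rel_def padic_vanishes_def rat_padic_abs_diff_commute)
  show "transp (padic_rel p)"
    unfolding padic_rel_def by (rule transpI) (force dest: padic_vanishes_add)
qed

lemma padic_rel_add:
  assumes "padic_rel p X X'" "padic_rel p Y Y'"
  shows "padic_rel p (\<lambda>n. X n + Y n) (\<lambda>n. X' n + Y' n)"
  using assms padic_vanishes_add[of "\<lambda>n. X n - X' n" "\<lambda>n. Y n - Y' n"]
  by (simp add: padic_rel_def padic_cauchy_add add_diff_add)

lemma padic_rel_minus:
  assumes "padic_rel p X X'"
  shows "padic_rel p (\<lambda>n. - X n) (\<lambda>n. - X' n)"
  using assms padic_vanishes_minus[of "\<lambda>n. X n - X' n"]
  by (simp add: padic_rel_def padic_cauchy_minus)

lemma padic_rel_mult: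
  assumes "padic_rel p X X'" "padic_rel p Y Y'"
  shows "padic_rel p (\<lambda>n. X n * Y n) (\<lambda>n. X' n * Y' n)"
proof -
  have "padic_vanishes p (\<lambda>n. X n * (Y n - Y' n) + Y' n * (X n - X' n))"
    using assms unfolding padic_rel_def
    by (intro padic_vanishes_add padic_vanishes_mult_bounded) auto
  moreover have "(\<lambda>n. X n * (Y n - Y' n) + Y' n * (X n - X' n)) = (\<lambda>n. X n * Y n - X' n * Y' n)"
    by (simp add: algebra_simps)
  ultimately show ?thesis using assms by (simp add: padic_rel_def padic_cauchy_mult)
qed

lemma padic_rel_inverse:
  assumes "padic_rel p X Y"
  shows "padic_rel p (if padic_vanishes p X then (\<lambda>n. 0) else (\<lambda>n. inverse (X n)))
    (if padic_vanishes p Y then (\<lambda>n. 0) else (\<lambda>n. inverse (Y n)))"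
  using assms padic_vanishes_cong[of X Y]
  by (simp add: padic_rel_def padic_cauchy_inverse padic_vanishes_inverse_diff)

lemma padic_rel_lim:
  assumes "padic_rel p X Y"
  shows "lim (\<lambda>n. rat_padic_abs p (X n)) = lim (\<lambda>n. rat_padic_abs p (Y n))"
proof -
  obtain L where L: "(\<lambda>n. rat_padic_abs p (X n)) \<longlonglongrightarrow> L"
    using padic_cauchy_Cauchy[of X] assms
    by (auto simp: Cauchy_convergent_iff convergent_def padic_rel_def)
  have "(\<lambda>n. rat_padic_abs p (X n) - rat_padic_abs p (Y n)) \<longlonglongrightarrow> 0"
    by (rule tendsto_0_le[where K = 1 and f = "\<lambda>n. rat_padic_abs p (X n - Y n)"])
      (use assms in \<open>auto simp: padic_rel_def padic_vanishes_def rat_padic_abs_triangle_rev\<close>)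
  from tendsto_diff[OF L this] have "(\<lambda>n. rat_padic_abs p (Y n)) \<longlonglongrightarrow> L" by simp
  thus ?thesis using L by (simp add: limI)
qed

end

text \<open>
  The prime is \<open>p = CARD('p)\<close>, and \<open>'p padic\<close> is the completion of the rationals with
  respect to the \<open>p\<close>-adic absolute value.
\<close>

typedef (overloaded) 'p padic =
  "{C. \<exists>X. padic_rel CARD('p::prime_card) X X \<and> C = Collect (padic_rel CARD('p) X)}"
  using padic_rel_refl[OF prime_card padic_cauchy_const[OF prime_card]] by blast

interpretation padic: quot_type "padic_rel CARD('p::prime_card)"
  "Abs_padic :: _ \<Rightarrow> 'p padic" Rep_padic
proof
  show "part_equivp (padic_rel CARD('p))" by (rule part_equivp_padic_rel[OF prime_card])
qed (use Rep_padic in \<open>auto simp: Rep_padic_inverse Abs_padic_inverse Rep_padic_inject\<close>)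

definition cr_padic :: "(nat \<Rightarrow> rat) \<Rightarrow> 'p::prime_card padic \<Rightarrow> bool" where
  "cr_padic X x \<longleftrightarrow> padic_rel CARD('p) X X \<and> padic.abs X = x"

lemma Quotient_padic:
  "Quotient (padic_rel CARD('p::prime_card)) padic.abs padic.rep
     (cr_padic :: _ \<Rightarrow> 'p padic \<Rightarrow> bool)"
  by (rule Quotient3_to_Quotient[OF padic.Quotient]) (rule eq_reflection, auto simp: cr_padic_def fun_eq_iff)

setup_lifting Quotient_padic

instantiation padic :: (prime_card) field
begin

lift_definition zero_padic :: "'a padic" is "\<lambda>n. 0"
  by (simp add: padic_rel_refl prime_card)

lift_definition one_padic :: "'a padic" is "\<lambda>n. 1"
  by (simp add: padic_rel_refl prime_card)

lift_definition plus_padic :: "'a padic \<Rightarrow> 'a padic \<Rightarrow> 'a padic" is "\<lambda>X Y n. X n + Y n"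
  by (rule padic_rel_add[OF prime_card])

lift_definition uminus_padic :: "'a padic \<Rightarrow> 'a padic" is "\<lambda>X n. - X n"
  by (rule padic_rel_minus[OF prime_card])

lift_definition times_padic :: "'a padic \<Rightarrow> 'a padic \<Rightarrow> 'a padic" is "\<lambda>X Y n. X n * Y n"
  by (rule padic_rel_mult[OF prime_card])

lift_definition inverse_padic :: "'a padic \<Rightarrow> 'a padic"
  is "\<lambda>X. if padic_vanishes CARD('a) X then (\<lambda>n. 0) else (\<lambda>n. inverse (X n))"
  by (rule padic_rel_inverse[OF prime_card])

definition "x - y = x + - y" for x y :: "'a padic"

definition "x div y = x * inverse y" for x y :: "'a padic"

instance
proof
  note P = prime_card[where 'a = 'a]
  note I = padic_rel_refl[OF P] padic_cauchy_add[OF P] padic_cauchy_mult[OF P]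
    padic_cauchy_minus[OF P] padic_cauchy_const[OF P]
  note R = padic_rel_def[of "CARD('a)"]
  fix a b c :: "'a padic"
  show "a + b = b + a"
    by transfer (auto simp: R add.commute I padic_vanishes_const[OF P])
  show "(a + b) + c = a + (b + c)"
    by transfer (auto simp: R add.assoc I padic_vanishes_const[OF P])
  show "0 + a = a"
    by transfer (auto simp: R I padic_vanishes_const[OF P])
  show "- a + a = 0"
    by transfer (auto simp: R I padic_vanishes_const[OF P])
  show "a - b = a + - b"
    by (rule minus_padic_def)
  show "(a * b) * c = a * (b * c)"
    by transfer (auto simp: R mult.assoc I padic_vanishes_const[OF P])
  show "a * b = b * a"
    by transfer (auto simp: R mult.commute I padic_vanishes_const[OF P])
  show "1 * a = a"
    by transfer (auto simp: R I padic_vanishes_const[OF P])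
  show "(a + b) * c = a * c + b * c"
    by transfer (auto simp: R distrib_right I padic_vanishes_const[OF P])
  show "(0::'a padic) \<noteq> 1"
    by transfer (simp add: R padic_vanishes_const[OF P])
  have "padic_vanishes CARD('a) (\<lambda>n. inverse (X n) * X n - 1)"
    if X: "padic_cauchy CARD('a) X" "\<not> padic_vanishes CARD('a) X" for X
  proof -
    obtain b N where b: "b > 0" "\<And>n. n \<ge> N \<Longrightarrow> b < rat_padic_abs CARD('a) (X n)"
      using padic_not_vanishes[OF P X] by blast
    have "X n \<noteq> 0" if "n \<ge> N" for n
      using b(1) b(2)[OF that] rat_padic_abs_0[OF P] by auto
    hence "\<forall>\<^sub>F n in sequentially. rat_padic_abs CARD('a) (inverse (X n) * X n - 1) = 0"
      unfolding eventually_sequentially by (intro exI[of _ N]) (simp add: rat_padic_abs_0[OF P])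
    thus ?thesis unfolding padic_vanishes_def by (rule tendsto_eventually)
  qed
  then show "a \<noteq> 0 \<Longrightarrow> inverse a * a = 1"
    by transfer (auto simp: R I padic_cauchy_inverse[OF P])
  show "a div b = a * inverse b"
    by (rule divide_padic_def)
  show "inverse (0::'a padic) = 0"
    by transfer (simp add: R I padic_vanishes_const[OF P])
qed

end

lift_definition padic_norm :: "'p::prime_card padic \<Rightarrow> real"
  is "\<lambda>X. lim (\<lambda>n. rat_padic_abs CARD('p) (X n))"
  by (rule padic_rel_lim[OF prime_card])

lemma padic_cauchy_tendsto_lim:
  fixes X :: "nat \<Rightarrow> rat"
  assumes "prime p" "padic_cauchy p X"
  shows "(\<lambda>n. rat_padic_abs p (X n)) \<longlonglongrightarrow> lim (\<lambda>n. rat_padic_abs p (X n))"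
  using padic_cauchy_Cauchy[OF assms] by (simp add: Cauchy_convergent_iff convergent_LIMSEQ_iff)

lemma padic_norm_eq_0: "padic_norm x = 0 \<longleftrightarrow> x = 0"
proof (transfer, goal_cases)
  case (1 X)
  hence X: "padic_cauchy CARD('a) X" by (simp add: padic_rel_def)
  have "lim (\<lambda>n. rat_padic_abs CARD('a) (X n)) = 0 \<longleftrightarrow> padic_vanishes CARD('a) X"
    unfolding padic_vanishes_def
    using padic_cauchy_tendsto_lim[OF prime_card X] by (metis limI)
  thus ?case using X by (simp add: padic_rel_def padic_cauchy_const[OF prime_card])
qed

lemma padic_norm_minus: "padic_norm (- x) = padic_norm x"
  by transfer (simp add: rat_padic_abs_minus[OF prime_card])

lemma padic_norm_mult: "padic_norm (x * y) = padic_norm x * padic_norm y"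
proof (transfer, goal_cases)
  case (1 X Y)
  hence "padic_cauchy CARD('a) X" "padic_cauchy CARD('a) Y" by (simp_all add: padic_rel_def)
  from tendsto_mult[OF this[THEN padic_cauchy_tendsto_lim[OF prime_card]]]
  show ?case by (simp add: rat_padic_abs_mult[OF prime_card] limI)
qed

lemma padic_norm_ultrametric: "padic_norm (x + y) \<le> max (padic_norm x) (padic_norm y)"
proof (transfer, goal_cases)
  case (1 X Y)
  hence X: "padic_cauchy CARD('a) X" and Y: "padic_cauchy CARD('a) Y"
    by (simp_all add: padic_rel_def)
  note L = padic_cauchy_tendsto_lim[OF prime_card]
  show ?case
    by (rule LIMSEQ_le[OF L[OF padic_cauchy_add[OF prime_card X Y]] tendsto_max[OF L[OF X] L[OF Y]]])
      (auto intro: rat_padic_abs_add[OF prime_card])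
qed

lemma padic_norm_nonneg: "0 \<le> padic_norm x"
proof (transfer, goal_cases)
  case (1 X)
  hence "padic_cauchy CARD('a) X" by (simp add: padic_rel_def)
  from padic_cauchy_tendsto_lim[OF prime_card this] show ?case
    by (rule LIMSEQ_le_const) (simp add: rat_padic_abs_nonneg[OF prime_card])
qed

instantiation padic :: (prime_card) metric_space
begin

definition dist_padic :: "'a padic \<Rightarrow> 'a padic \<Rightarrow> real" where
  "dist_padic x y = padic_norm (x - y)"

definition uniformity_padic :: "('a padic \<times> 'a padic) filter" where
  "uniformity_padic = (INF e\<in>{0 <..}. principal {(x, y). dist x y < e})"

definition open_padic :: "'a padic set \<Rightarrow> bool" where
  "open_padic U \<longleftrightarrow> (\<forall>x\<in>U. eventually (\<lambda>(x', y). x' = x \<longrightarrow> y \<in> U) uniformity)"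

instance
proof
  fix x y z :: "'a padic"
  show "dist x y = 0 \<longleftrightarrow> x = y"
    by (simp add: dist_padic_def padic_norm_eq_0)
  have "padic_norm (x - y) \<le> max (padic_norm (x - z)) (padic_norm (z - y))"
    using padic_norm_ultrametric[of "x - z" "z - y"] by simp
  moreover have "padic_norm (z - y) = padic_norm (y - z)"
    using padic_norm_minus[of "z - y"] by simp
  ultimately show "dist x y \<le> dist x z + dist y z"
    using padic_norm_nonneg[of "x - z"] padic_norm_nonneg[of "y - z"]
    unfolding dist_padic_def by linarith
qed (simp_all add: uniformity_padic_def open_padic_def)

end

definition padic_balls :: "'p::prime_card padic set set" where
  "padic_balls = {{x. padic_norm (x - a) \<le> of_nat CARD('p) powi k} | a k. True}"

definition ball_morphism :: "('p::prime_card padic \<Rightarrow> 'p padic) \<Rightarrow> bool" where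
  "ball_morphism \<phi> \<longleftrightarrow>
     bij \<phi> \<and> (\<forall>B\<in>padic_balls. \<phi> ` B \<in> padic_balls \<and> \<phi> -` B \<in> padic_balls)"

definition padic_isometry :: "('p::prime_card padic \<Rightarrow> 'p padic) \<Rightarrow> bool" where
  "padic_isometry \<psi> \<longleftrightarrow> bij \<psi> \<and> (\<forall>x y. padic_norm (\<psi> x - \<psi> y) = padic_norm (x - y))"

text \<open>
  For \<open>x = y\<close> there is no minimal ball and the value is unspecified; the integrand
  below vanishes there because of the factor \<open>f x - f y\<close>.
\<close>

definition padic_sup :: "'p::prime_card padic \<Rightarrow> 'p padic \<Rightarrow> 'p padic set" where
  "padic_sup x y = (THE B. B \<in> padic_balls \<and> x \<in> B \<and> y \<in> B \<and>
     (\<forall>B'\<in>padic_balls. x \<in> B' \<and> y \<in> B' \<longrightarrow> B \<subseteq> B'))"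

text \<open>
  The normalized Haar measure, as a Borel measure. Regularity and local finiteness are not
  listed: they follow, the space being separable and covered by countably many translates of
  the unit ball.
\<close>

definition padic_haar :: "'p::prime_card padic measure \<Rightarrow> bool" where
  "padic_haar \<mu> \<longleftrightarrow> sets \<mu> = sets borel \<and>
     (\<forall>a. \<forall>A\<in>sets borel. emeasure \<mu> ((\<lambda>x. a + x) ` A) = emeasure \<mu> A) \<and>
     emeasure \<mu> {x. padic_norm x \<le> 1} = 1"

text \<open>
  A function on balls is represented by a function on all sets; by the choice of
  \<open>padic_sup\<close>, only its values on balls matter.
\<close>

definition padic_D_integrand ::
  "('p::prime_card padic set \<Rightarrow> complex) \<Rightarrow> ('p padic \<Rightarrow> complex) \<Rightarrow> 'p padic \<Rightarrow> 'p padic \<Rightarrow> complex"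
  where "padic_D_integrand F f x y = F (padic_sup x y) * (f x - f y)"

definition padic_D :: "'p::prime_card padic measure \<Rightarrow> ('p padic set \<Rightarrow> complex) \<Rightarrow>
    ('p padic \<Rightarrow> complex) \<Rightarrow> 'p padic \<Rightarrow> complex" where
  "padic_D \<mu> F f x = (LINT y|\<mu>. padic_D_integrand F f x y)"

end

theory Submission
  imports Defs
begin

text \<open>
  The rule is the change of variables \<open>y = \<phi> z\<close> in the integral. A ball-morphism transports
  minimal balls, so \<open>padic_sup (\<phi> x) (\<phi> z)\<close> is the image of \<open>padic_sup x z\<close>
  (\<open>padic_sup_ball_morphism\<close>), and the integrand of \<open>D\<^sub>F f\<close> at \<open>\<phi> x\<close>, composed with \<open>\<phi>\<close>, is the
  integrand of the transported operator at \<open>x\<close> (\<open>padic_D_integrand_ball_morphism\<close>). It remains to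
  see that the map scales Haar measure by the factor \<open>p powi (- \<gamma>)\<close>.

  For this, \<open>\<phi>\<close> enters as a surjective similarity: it multiplies distances by
  \<open>p powi (- \<gamma>)\<close>, because \<open>p\<close> has norm \<open>1 / p\<close>. The preimage of a ball of radius \<open>p powi k\<close> is
  therefore a ball of radius \<open>p powi (\<gamma> + k)\<close>. Haar measure of a ball equals its radius
  (\<open>padic_haar_cball\<close>): a ball splits into \<open>p\<close> disjoint translates of the next smaller
  one, since the residue field has \<open>p\<close> elements. Hence the image measure of \<open>\<mu>\<close> under \<open>\<phi>\<close> and the
  multiple \<open>p powi \<gamma>\<close> of \<open>\<mu>\<close> agree on balls, and by uniqueness of measures on an
  intersection-stable generator they coincide (\<open>padic_haar_distr\<close>).
\<close>

section \<open>Rational numbers inside the p-adic field\<close>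

lift_definition padic_of_rat :: "rat \<Rightarrow> 'p::prime_card padic" is "\<lambda>q n. q"
  by (simp add: padic_rel_refl prime_card padic_cauchy_const)

lemma padic_of_rat_0 [simp]: "padic_of_rat 0 = 0"
  by transfer (simp add: padic_rel_refl prime_card padic_cauchy_const)

lemma padic_of_rat_1 [simp]: "padic_of_rat 1 = 1"
  by transfer (simp add: padic_rel_refl prime_card padic_cauchy_const)

lemma padic_of_rat_add: "padic_of_rat (q + r) = padic_of_rat q + padic_of_rat r"
  by transfer (simp add: padic_rel_refl prime_card padic_cauchy_const)

lemma padic_of_rat_minus: "padic_of_rat (- q) = - padic_of_rat q"
  by transfer (simp add: padic_rel_refl prime_card padic_cauchy_const)

lemma padic_of_rat_diff: "padic_of_rat (q - r) = padic_of_rat q - padic_of_rat r"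
  using padic_of_rat_add[of q "- r"] by (simp add: padic_of_rat_minus)

lemma padic_of_rat_of_nat [simp]: "padic_of_rat (of_nat n) = of_nat n"
  by (induction n) (simp_all add: padic_of_rat_add)

lemma padic_norm_of_rat: "padic_norm (padic_of_rat q :: 'p::prime_card padic) = rat_padic_abs CARD('p) q"
  by transfer (simp add: limI)

lemma padic_of_rat_dense:
  fixes x :: "'p::prime_card padic"
  assumes "e > 0"
  shows "\<exists>q. padic_norm (x - padic_of_rat q) \<le> e"
  using assms unfolding minus_padic_def
proof (transfer fixing: e, goal_cases)
  case (1 X)
  hence X: "padic_cauchy CARD('p) X" by (simp add: padic_rel_def)
  obtain N where N: "\<forall>m\<ge>N. \<forall>n\<ge>N. rat_padic_abs CARD('p) (X m - X n) < e"
    using X 1 unfolding padic_cauchy_def by blast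
  have "padic_cauchy CARD('p) (\<lambda>n. X n + - X N)"
    by (intro padic_cauchy_add[OF prime_card] X padic_cauchy_const[OF prime_card])
  from padic_cauchy_tendsto_lim[OF prime_card this]
  have "lim (\<lambda>n. rat_padic_abs CARD('p) (X n + - X N)) \<le> e"
    by (rule LIMSEQ_le_const2) (use N in \<open>auto intro!: exI[of _ N] less_imp_le\<close>)
  thus ?case by auto
qed

lemma padic_norm_0 [simp]: "padic_norm 0 = 0"
  by (simp add: padic_norm_eq_0)

lemma padic_norm_1 [simp]: "padic_norm (1 :: 'p::prime_card padic) = 1"
  using padic_norm_of_rat[of 1, where 'p = 'p] by (simp add: rat_padic_abs_1[OF prime_card])

lemma padic_norm_of_nat_less:
  assumes "0 < n" "n < CARD('p)"
  shows "padic_norm (of_nat n :: 'p::prime_card padic) = 1"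
proof -
  have "\<not> int CARD('p) dvd int n" using assms by (auto dest: dvd_imp_le)
  hence "multiplicity (int CARD('p)) (int n) = 0" by (rule not_dvd_imp_multiplicity_0)
  moreover have "(of_nat n :: rat) = Rat.Fract (int n) 1" by (simp add: of_nat_rat)
  ultimately have "rat_padic_abs CARD('p) (of_nat n) = 1"
    using assms by (simp add: rat_padic_abs_Fract[OF prime_card])
  thus ?thesis by (simp flip: padic_norm_of_rat[where 'p = 'p])
qed

lemma padic_norm_prime: "padic_norm (of_nat CARD('p) :: 'p::prime_card padic) = inverse (real CARD('p))"
proof -
  have p: "prime (int CARD('p))" using prime_card[where 'a = 'p] by simp
  have "(of_nat CARD('p) :: rat) = Rat.Fract (int CARD('p)) 1" by (simp add: of_nat_rat)
  moreover have "multiplicity (int CARD('p)) (int CARD('p)) = 1"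
    using p by (intro multiplicity_self) auto
  ultimately have "rat_padic_abs CARD('p) (of_nat CARD('p)) = inverse (real CARD('p))"
    by (simp add: rat_padic_abs_Fract[OF prime_card] power_int_minus)
  thus ?thesis by (simp flip: padic_norm_of_rat[where 'p = 'p])
qed

lemma padic_norm_inverse: "padic_norm (inverse x) = inverse (padic_norm x)"
proof (cases "x = 0")
  case False
  hence "padic_norm x * padic_norm (inverse x) = 1" by (simp flip: padic_norm_mult)
  thus ?thesis by (metis inverse_unique)
qed simp

lemma padic_norm_power: "padic_norm (x ^ n) = padic_norm x ^ n"
  by (induction n) (simp_all add: padic_norm_mult)

lemma padic_norm_prime_powi:
  "padic_norm (of_nat CARD('p) powi k :: 'p::prime_card padic) = real CARD('p) powi (- k)"
  by (simp add: power_int_def padic_norm_power padic_norm_inverse padic_norm_prime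
      power_inverse)

section \<open>Residues modulo p\<close>

text \<open>
  Write the rational as a reduced fraction \<open>a / b\<close>. Norm at most one forces \<open>p\<close> not to divide
  \<open>b\<close>, so \<open>b\<close> is invertible modulo \<open>p\<close>, and \<open>i\<close> is the residue of \<open>a / b\<close>.
\<close>

lemma rat_residue:
  assumes p: "prime p" and "rat_padic_abs p q \<le> 1"
  shows "\<exists>i<p. rat_padic_abs p (q - of_nat i) \<le> inverse (real p)"
proof -
  obtain a b where q: "q = Rat.Fract a b" "b > 0" "coprime a b" by (rule Rat_cases)
  have p': "prime (int p)" and p1: "real p > 1" using p prime_gt_1_nat by auto
  have b: "\<not> int p dvd b"
  proof
    assume d: "int p dvd b"
    hence "\<not> int p dvd a" using q(3) p' by (meson coprime_common_divisor not_prime_unit)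
    hence a: "a \<noteq> 0" "multiplicity (int p) a = 0" by (auto simp: not_dvd_imp_multiplicity_0)
    have "multiplicity (int p) b > 0"
      using d q(2) p' by (simp add: prime_multiplicity_gt_zero_iff)
    hence "rat_padic_abs p q > 1"
      using a q p1 by (simp add: rat_padic_abs_Fract[OF p] one_less_power)
    thus False using assms by simp
  qed
  hence "coprime (int p) b" using p' by (simp add: prime_imp_coprime)
  then obtain c where c: "[b * c = 1] (mod int p)"
    using cong_solve_coprime_int by (metis coprime_commute)
  define i where "i = nat ((a * c) mod int p)"
  have i: "i < p" "int i = (a * c) mod int p" using p1 by (auto simp: i_def nat_less_iff)
  have "[int i * b = a * c * b] (mod int p)" unfolding i(2) cong_def by (simp add: mod_mult_left_eq)
  also have "a * c * b = a * (b * c)" by simp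
  also have "[a * (b * c) = a * 1] (mod int p)" by (intro cong_mult c cong_refl)
  finally have d: "int p dvd a - int i * b" by (simp add: cong_iff_dvd_diff dvd_diff_commute)
  have eq: "q - of_nat i = Rat.Fract (a - int i * b) b" using q by (simp add: of_nat_rat)
  have "rat_padic_abs p (q - of_nat i) \<le> inverse (real p)"
  proof (cases "a - int i * b = 0")
    case True
    thus ?thesis unfolding eq by (simp add: rat_number_collapse rat_padic_abs_0[OF p])
  next
    case False
    hence "multiplicity (int p) (a - int i * b) > 0"
      using d p' by (simp add: prime_multiplicity_gt_zero_iff)
    moreover have "multiplicity (int p) b = 0" using b by (rule not_dvd_imp_multiplicity_0)
    ultimately have "int (multiplicity (int p) b) - int (multiplicity (int p) (a - int i * b)) \<le> -1"
      by simp
    hence "real p powi (int (multiplicity (int p) b) - int (multiplicity (int p) (a - int i * b)))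
        \<le> real p powi (-1)"
      using p1 by (intro power_int_increasing) auto
    hence "rat_padic_abs p (q - of_nat i) \<le> real p powi (-1)"
      unfolding eq using False q(2) by (subst rat_padic_abs_Fract[OF p]) auto
    thus ?thesis by (simp add: power_int_minus)
  qed
  thus ?thesis using i by blast
qed

text \<open>
  By density, a p-adic integer is close to a rational of norm at most one, whose residue serves for it
  as well. Together with \<open>padic_norm_of_nat_less\<close> this says that the residue field has exactly
  \<open>p\<close> elements.
\<close>

lemma padic_residue:
  fixes x :: "'p::prime_card padic"
  assumes "padic_norm x \<le> 1"
  shows "\<exists>i<CARD('p). padic_norm (x - of_nat i) \<le> inverse (real CARD('p))"
proof -
  have p1: "real CARD('p) > 1" using prime_gt_1_nat[OF prime_card] by simp
  then obtain q where q: "padic_norm (x - padic_of_rat q) \<le> inverse (real CARD('p))"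
    using padic_of_rat_dense[of "inverse (real CARD('p))" x] by auto
  have "inverse (real CARD('p)) \<le> 1" using p1 by (simp add: inverse_le_1_iff)
  hence "padic_norm (padic_of_rat q :: 'p padic) \<le> 1"
    using padic_norm_ultrametric[of "padic_of_rat q - x" x] q assms
      padic_norm_minus[of "x - padic_of_rat q"] by simp
  then obtain i where i: "i < CARD('p)"
    "padic_norm (padic_of_rat q - of_nat i :: 'p padic) \<le> inverse (real CARD('p))"
    using rat_residue[OF prime_card, of q, where 'a1 = 'p]
    by (auto simp flip: padic_norm_of_rat[where 'p = 'p] simp: padic_of_rat_diff)
  thus ?thesis
    using padic_norm_ultrametric[of "x - padic_of_rat q" "padic_of_rat q - of_nat i"] q by auto
qed

section \<open>Ultrametric balls\<close>

lemma padic_balls_eq_cball: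
  "padic_balls = {cball a (real CARD('p) powi k) | (a :: 'p::prime_card padic) k. True}"
proof -
  have "{x. padic_norm (x - a) \<le> r} = cball a r" for a :: "'p padic" and r
    by (auto simp: cball_def dist_padic_def simp flip: padic_norm_minus[of "a - _"])
  thus ?thesis by (simp add: padic_balls_def)
qed

lemma padic_dist_ultrametric: "dist x z \<le> max (dist x y) (dist y z)" for x y z :: "'p::prime_card padic"
  using padic_norm_ultrametric[of "x - y" "y - z"] by (simp add: dist_padic_def)

text \<open>
  Every point of an ultrametric ball is a centre of it; hence two balls that meet are nested.
\<close>

lemma padic_cball_subset:
  fixes a b :: "'p::prime_card padic"
  assumes "r \<le> s" "z \<in> cball a r" "z \<in> cball b s"
  shows "cball a r \<subseteq> cball b s"
proof
  fix y assume "y \<in> cball a r"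
  hence "dist z y \<le> s"
    using assms padic_dist_ultrametric[of z y a] by (simp add: dist_commute)
  thus "y \<in> cball b s"
    using assms padic_dist_ultrametric[of b y z] by simp
qed

lemma padic_translate_cball: "(\<lambda>x. c + x) ` cball a r = cball (c + a) r" for a :: "'p::prime_card padic"
proof -
  have "y \<in> (\<lambda>x. c + x) ` cball a r" if "dist (c + a) y \<le> r" for y
    using that by (intro image_eqI[of _ _ "y - c"]) (simp_all add: dist_padic_def algebra_simps)
  thus ?thesis by (auto simp: dist_padic_def)
qed

text \<open>
  Multiplication by the power of \<open>p\<close> with exponent \<open>k + 1\<close> carries the ball to the unit ball,
  where the residue classes modulo \<open>p\<close> give the pieces.
\<close>

lemma padic_cball_split:
  "cball (0 :: 'p::prime_card padic) (real CARD('p) powi (k + 1)) =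
    (\<Union>i<CARD('p). cball (of_nat i * of_nat CARD('p) powi (- k - 1)) (real CARD('p) powi k))"
    (is "?B = (\<Union>i<_. cball (?c i) _)")
proof
  have p1: "real CARD('p) > 1" using prime_gt_1_nat[OF prime_card] by simp
  have P0: "(of_nat CARD('p) :: 'p padic) \<noteq> 0"
    using padic_norm_prime[where 'p = 'p] p1 by (metis inverse_nonzero_iff_nonzero less_irrefl not_one_less_zero padic_norm_0)
  show "?B \<subseteq> (\<Union>i<CARD('p). cball (?c i) (real CARD('p) powi k))"
  proof
    fix x assume "x \<in> ?B"
    hence x: "padic_norm x \<le> real CARD('p) powi (k + 1)" by (simp add: dist_padic_def padic_norm_minus)
    let ?s = "of_nat CARD('p) powi (k + 1) :: 'p padic"
    have "padic_norm (?s * x) \<le> real CARD('p) powi (- (k + 1)) * real CARD('p) powi (k + 1)"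
      unfolding padic_norm_mult padic_norm_prime_powi using x p1 by (intro mult_left_mono) auto
    also have "\<dots> = 1" using p1 by (simp flip: power_int_add)
    finally obtain i where i: "i < CARD('p)" "padic_norm (?s * x - of_nat i) \<le> inverse (real CARD('p))"
      using padic_residue by blast
    have s: "?s * of_nat CARD('p) powi (- k - 1) = 1" using P0 by (simp flip: power_int_add)
    have "x - ?c i = of_nat CARD('p) powi (- k - 1) * (?s * x - of_nat i)"
      using s by (simp add: algebra_simps) 
    hence "padic_norm (x - ?c i) =
        real CARD('p) powi (k + 1) * padic_norm (?s * x - of_nat i)"
      by (simp add: padic_norm_mult padic_norm_prime_powi[of "- k - 1"] add.commute)
    also have "\<dots> \<le> real CARD('p) powi (k + 1) * inverse (real CARD('p))"
      using i(2) p1 by (intro mult_left_mono) auto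
    also have "\<dots> = real CARD('p) powi k" using p1 by (simp add: power_int_add)
    finally show "x \<in> (\<Union>i<CARD('p). cball (?c i) (real CARD('p) powi k))"
      using i(1) by (auto simp: dist_padic_def simp flip: padic_norm_minus[of "_ - x"])
  qed
  show "(\<Union>i<CARD('p). cball (?c i) (real CARD('p) powi k)) \<subseteq> ?B"
  proof (rule UN_least)
    fix i assume "i \<in> {..<CARD('p)}"
    hence "padic_norm (of_nat i :: 'p padic) \<le> 1"
      using padic_norm_of_nat_less[of i, where 'p = 'p] by (cases "i = 0") auto
    hence "?c i \<in> ?B" using p1
      by (simp add: dist_padic_def padic_norm_minus padic_norm_mult padic_norm_prime_powi[of "- k - 1"] mult_left_le_one_le padic_norm_nonneg add.commute)
    moreover have "real CARD('p) powi k \<le> real CARD('p) powi (k + 1)"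
      using p1 by (intro power_int_increasing) auto
    ultimately show "cball (?c i) (real CARD('p) powi k) \<subseteq> ?B"
      using p1 by (intro padic_cball_subset[of _ _ "?c i"]) auto
  qed
qed

lemma padic_cball_split_disjoint:
  "disjoint_family_on (\<lambda>i. cball (of_nat i * of_nat CARD('p) powi (- k - 1) :: 'p::prime_card padic)
     (real CARD('p) powi k)) {..<CARD('p)}" (is "disjoint_family_on (\<lambda>i. cball (?c i) _) _")
proof -
  have p1: "real CARD('p) > 1" using prime_gt_1_nat[OF prime_card] by simp
  have far: "dist (?c i) (?c j) > real CARD('p) powi k" if "i < j" "j < CARD('p)" for i j
  proof -
    have "?c j - ?c i = of_nat (j - i) * of_nat CARD('p) powi (- k - 1)"
      using that by (simp add: of_nat_diff algebra_simps)
    hence "dist (?c j) (?c i) = real CARD('p) powi (k + 1)"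
      using that by (simp add: dist_padic_def padic_norm_mult padic_norm_prime_powi[of "- k - 1"]
          padic_norm_of_nat_less add.commute del: of_nat_diff)
    thus ?thesis using p1 by (simp add: dist_commute power_int_strict_increasing)
  qed
  show ?thesis
  proof (unfold disjoint_family_on_def, intro ballI impI)
    fix i j assume ij: "i \<in> {..<CARD('p)}" "j \<in> {..<CARD('p)}" "i \<noteq> j"
    have "dist (?c i) (?c j) > real CARD('p) powi k"
      using far[of i j] far[of j i] ij by (cases i j rule: linorder_cases) (auto simp: dist_commute)
    moreover have "dist (?c i) (?c j) \<le> real CARD('p) powi k"
      if "z \<in> cball (?c i) (real CARD('p) powi k)" "z \<in> cball (?c j) (real CARD('p) powi k)" for z
      using that padic_dist_ultrametric[of "?c i" "?c j" z] by (simp add: dist_commute)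
    ultimately show "cball (?c i) (real CARD('p) powi k) \<inter> cball (?c j) (real CARD('p) powi k) = {}"
      by fastforce
  qed
qed

section \<open>Haar measure and similarities\<close>

text \<open>
  Splitting into \<open>p\<close> disjoint translates multiplies the measure by \<open>p\<close> when the radius exponent
  rises by one. The normalization fixes exponent zero, and induction in both directions reaches
  every integer exponent.
\<close>

lemma padic_haar_cball:
  fixes a :: "'p::prime_card padic"
  assumes "padic_haar \<mu>"
  shows "emeasure \<mu> (cball a (real CARD('p) powi k)) = ennreal (real CARD('p) powi k)"
proof -
  have p1: "real CARD('p) > 1" using prime_gt_1_nat[OF prime_card] by simp
  have sets: "sets \<mu> = sets borel" and inv: "\<And>c A. A \<in> sets borel \<Longrightarrow> emeasure \<mu> ((\<lambda>x. c + x) ` A) = emeasure \<mu> A"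
    and unit: "emeasure \<mu> {x. padic_norm x \<le> 1} = 1"
    using assms by (auto simp: padic_haar_def)
  have tr: "emeasure \<mu> (cball c r) = emeasure \<mu> (cball 0 r)" for c :: "'p padic" and r
    using inv[of "cball 0 r" c] by (simp add: padic_translate_cball)
  have step: "emeasure \<mu> (cball 0 (real CARD('p) powi (j + 1))) =
      ennreal (real CARD('p)) * emeasure \<mu> (cball 0 (real CARD('p) powi j))" for j
  proof -
    have "emeasure \<mu> (cball 0 (real CARD('p) powi (j + 1))) =
      (\<Sum>i<CARD('p). emeasure \<mu> (cball (of_nat i * of_nat CARD('p) powi (- j - 1)) (real CARD('p) powi j)))"
      unfolding padic_cball_split
      by (rule sum_emeasure[symmetric]) (auto simp: sets padic_cball_split_disjoint)
    also have "\<dots> = (\<Sum>i<CARD('p). emeasure \<mu> (cball 0 (real CARD('p) powi j)))"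
      by (intro sum.cong refl tr)
    finally show ?thesis by (simp add: ennreal_of_nat_eq_real_of_nat)
  qed
  have "emeasure \<mu> (cball 0 (real CARD('p) powi k)) = ennreal (real CARD('p) powi k)"
  proof (induction k rule: int_induct[where k = 0])
    case base
    have "cball 0 1 = {x :: 'p padic. padic_norm x \<le> 1}"
      by (auto simp: dist_padic_def padic_norm_minus)
    thus ?case using unit by simp
  next
    case (step1 i)
    hence "emeasure \<mu> (cball 0 (real CARD('p) powi (i + 1))) =
        ennreal (real CARD('p)) * ennreal (real CARD('p) powi i)"
      using step[of i] by simp
    thus ?case using p1 by (simp add: power_int_add mult.commute flip: ennreal_mult')
  next
    case (step2 i)
    have "real CARD('p) powi i = real CARD('p) * real CARD('p) powi (i - 1)"
      using p1 by (simp add: power_int_diff)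
    hence "ennreal (real CARD('p)) * emeasure \<mu> (cball 0 (real CARD('p) powi (i - 1))) =
        ennreal (real CARD('p)) * ennreal (real CARD('p) powi (i - 1))"
      using step[of "i - 1"] step2 p1 by (simp add: ennreal_mult')
    thus ?case using p1 by (subst (asm) ennreal_mult_cancel_left) auto
  qed
  thus ?thesis by (subst tr)
qed

lemma padic_powi_small:
  assumes "e > 0"
  shows "\<exists>k::int. real CARD('p::prime_card) powi k < e"
proof -
  have p1: "real CARD('p) > 1" using prime_gt_1_nat[OF prime_card] by simp
  then obtain n where "inverse (real CARD('p)) ^ n < e"
    using real_arch_pow_inv[of e "inverse (real CARD('p))"] assms by (auto simp: inverse_less_1_iff)
  thus ?thesis by (intro exI[of _ "- int n"]) (simp add: power_int_minus power_inverse)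
qed

text \<open>
  The rationals are dense, so every open set is the union of the countably many balls with
  rational centre that it contains. The empty set is added because the generator has to be closed
  under intersection.
\<close>

lemma borel_padic_balls: "sets borel = sigma_sets UNIV (insert {} (padic_balls :: 'p::prime_card padic set set))"
proof
  have p1: "real CARD('p) > 1" using prime_gt_1_nat[OF prime_card] by simp
  have "insert {} padic_balls \<subseteq> sets (borel :: 'p padic measure)"
    by (auto simp: padic_balls_eq_cball)
  from sets.sigma_sets_subset[OF this]
  show "sigma_sets UNIV (insert {} padic_balls) \<subseteq> sets (borel :: 'p padic measure)" by simp
  have "S \<in> sigma_sets UNIV (insert {} padic_balls)" if "open S" for S :: "'p padic set"
  proof -
    let ?b = "\<lambda>(q, k::int). cball (padic_of_rat q :: 'p padic) (real CARD('p) powi k)"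
    have "\<exists>i. x \<in> ?b i \<and> ?b i \<subseteq> S" if x: "x \<in> S" for x
    proof -
      obtain e where e: "e > 0" "cball x e \<subseteq> S" using \<open>open S\<close> x open_contains_cball by blast
      obtain k :: int where k: "real CARD('p) powi k < e" using padic_powi_small[OF e(1)] by blast
      obtain q where q: "padic_norm (x - padic_of_rat q) \<le> real CARD('p) powi k"
        using padic_of_rat_dense[of "real CARD('p) powi k" x] p1 by auto
      hence xb: "x \<in> ?b (q, k)" by (simp add: dist_padic_def flip: padic_norm_minus[of "x - _"])
      hence "?b (q, k) \<subseteq> cball x e"
        unfolding prod.case using k e by (intro padic_cball_subset[of _ _ x]) auto
      hence "?b (q, k) \<subseteq> S" using e(2) by (rule subset_trans)
      with xb show ?thesis by (intro exI conjI)
    qed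
    hence "S = \<Union> (?b ` {i. ?b i \<subseteq> S})" by (intro equalityI subsetI) fastforce+
    moreover have "\<Union> (?b ` {i. ?b i \<subseteq> S}) \<in> sigma_sets UNIV (insert {} padic_balls)"
    proof (rule sigma_sets_UNION)
      show "countable (?b ` {i. ?b i \<subseteq> S})" by (intro countable_image countableI_type)
      fix B assume "B \<in> ?b ` {i. ?b i \<subseteq> S}"
      then obtain i where "B = ?b i" by (rule imageE)
      hence "B \<in> padic_balls" by (cases i) (auto simp: padic_balls_eq_cball)
      thus "B \<in> sigma_sets UNIV (insert {} padic_balls)" by (intro sigma_sets.Basic insertI2)
    qed
    ultimately show ?thesis by (rule ssubst)
  qed
  thus "sets borel \<subseteq> sigma_sets UNIV (insert {} (padic_balls :: 'p padic set set))"
    unfolding sets_borel by (intro sigma_sets_mono subsetI) (simp only: mem_Collect_eq)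
qed

lemma padic_balls_Int_stable: "Int_stable (insert {} (padic_balls :: 'p::prime_card padic set set))"
proof (rule Int_stableI)
  have *: "A \<inter> B = {} \<or> A \<inter> B = A \<or> A \<inter> B = B"
    if "A \<in> padic_balls" "B \<in> padic_balls" for A B :: "'p padic set"
  proof -
    obtain a r b s where "A = cball a r" "B = cball b s"
      using \<open>A \<in> _\<close> \<open>B \<in> _\<close> by (auto simp: padic_balls_eq_cball)
    thus ?thesis using padic_cball_subset[of r s _ a b] padic_cball_subset[of s r _ b a]
      by (cases "r \<le> s") (auto, (meson linear subsetD mem_cball)+)
  qed
  show "A \<inter> B \<in> insert {} padic_balls"
    if "A \<in> insert {} padic_balls" "B \<in> insert {} padic_balls" for A B :: "'p padic set"
    using that *[of A B] by auto
qed

lemma padic_similarity_measurable: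
  fixes \<phi> :: "'p::prime_card padic \<Rightarrow> 'p padic"
  assumes sim: "\<And>x y. dist (\<phi> x) (\<phi> y) = real CARD('p) powi (- \<gamma>) * dist x y"
  shows "\<phi> \<in> measurable borel borel"
proof (rule borel_measurable_continuous_onI, rule lipschitz_on_continuous_on)
  show "(real CARD('p) powi (- \<gamma>))-lipschitz_on UNIV \<phi>"
    by (rule lipschitz_onI) (auto simp: sim)
qed

text \<open>
  The preimage of a ball is a ball with radius exponent raised by \<open>\<gamma>\<close>, so both measures give
  the ball the same value. Balls form an intersection-stable generator of the Borel sets that contains an
  exhaustion by sets of finite measure, so the measures agree. The density is constant: this is
  the measure \<open>\<mu>\<close> multiplied by a positive number.
\<close>

lemma padic_haar_distr:
  fixes \<phi> :: "'p::prime_card padic \<Rightarrow> 'p padic"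
  assumes haar: "padic_haar \<mu>" and "surj \<phi>"
    and sim: "\<And>x y. dist (\<phi> x) (\<phi> y) = real CARD('p) powi (- \<gamma>) * dist x y"
  shows "distr \<mu> borel \<phi> = density \<mu> (\<lambda>_. ennreal (real CARD('p) powi \<gamma>))"
proof -
  have p1: "real CARD('p) > 1" using prime_gt_1_nat[OF prime_card] by simp
  have sets: "sets \<mu> = sets borel" using haar by (simp add: padic_haar_def)
  hence space: "space \<mu> = UNIV" using sets_eq_imp_space_eq by fastforce
  have pre: "\<phi> -` cball (\<phi> a) (real CARD('p) powi k) = cball a (real CARD('p) powi (\<gamma> + k))" for a k
  proof -
    have "real CARD('p) powi (- \<gamma>) * d \<le> real CARD('p) powi k \<longleftrightarrow> d \<le> real CARD('p) powi (\<gamma> + k)" for d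
      using p1 by (simp add: power_int_minus power_int_add field_simps)
    thus ?thesis by (auto simp: sim)
  qed
  have meas: "\<phi> \<in> measurable \<mu> borel"
    using padic_similarity_measurable[OF sim] measurable_cong_sets[OF sets refl] by blast
  show ?thesis
  proof (rule measure_eqI_generator_eq[OF padic_balls_Int_stable])
    show "insert {} padic_balls \<subseteq> Pow UNIV" by simp
    show "sets (distr \<mu> borel \<phi>) = sigma_sets UNIV (insert {} padic_balls)"
      "sets (density \<mu> (\<lambda>_. ennreal (real CARD('p) powi \<gamma>))) = sigma_sets UNIV (insert {} padic_balls)"
      by (simp_all add: sets borel_padic_balls)
    have distr: "emeasure (distr \<mu> borel \<phi>) (cball b (real CARD('p) powi k)) =
        ennreal (real CARD('p) powi (\<gamma> + k))" for b k
    proof -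
      obtain a where "b = \<phi> a" using \<open>surj \<phi>\<close> by blast
      thus ?thesis by (simp add: emeasure_distr[OF meas] space pre padic_haar_cball[OF haar])
    qed
    show "emeasure (distr \<mu> borel \<phi>) B = emeasure (density \<mu> (\<lambda>_. ennreal (real CARD('p) powi \<gamma>))) B"
      if "B \<in> insert {} padic_balls" for B
      using that p1 by (auto simp: padic_balls_eq_cball distr padic_haar_cball[OF haar]
          power_int_add ennreal_mult' emeasure_density_const sets)
    let ?A = "\<lambda>n. cball (0 :: 'p padic) (real CARD('p) powi int n)"
    show "range ?A \<subseteq> insert {} padic_balls" unfolding padic_balls_eq_cball by blast
    show "(\<Union>n. ?A n) = UNIV"
    proof -
      have "\<exists>n. dist 0 x \<le> real CARD('p) powi int n" for x :: "'p padic"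
        using real_arch_pow[OF p1, of "dist 0 x"] by (auto intro: less_imp_le)
      thus ?thesis by auto
    qed
    show "emeasure (distr \<mu> borel \<phi>) (?A n) \<noteq> \<infinity>" for n by (simp only: distr) simp
  qed
qed

lemma padic_haar_integral_similarity:
  fixes \<phi> :: "'p::prime_card padic \<Rightarrow> 'p padic" and g :: "'p padic \<Rightarrow> complex"
  assumes haar: "padic_haar \<mu>" and "surj \<phi>"
    and sim: "\<And>x y. dist (\<phi> x) (\<phi> y) = real CARD('p) powi (- \<gamma>) * dist x y"
    and g: "g \<in> borel_measurable \<mu>"
  shows "(LINT y|\<mu>. g y) = of_real (real CARD('p) powi (- \<gamma>)) * (LINT y|\<mu>. g (\<phi> y))"
proof -
  have p1: "real CARD('p) > 1" using prime_gt_1_nat[OF prime_card] by simp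
  have sets: "sets \<mu> = sets borel" using haar by (simp add: padic_haar_def)
  have meas: "\<phi> \<in> measurable \<mu> borel"
    using padic_similarity_measurable[OF sim] measurable_cong_sets[OF sets refl] by blast
  have g': "g \<in> borel_measurable borel" using g measurable_cong_sets[OF sets refl] by blast
  have "(LINT y|\<mu>. g (\<phi> y)) = (LINT y|distr \<mu> borel \<phi>. g y)"
    by (rule integral_distr[OF meas g', symmetric])
  also have "\<dots> = (LINT y|\<mu>. (real CARD('p) powi \<gamma>) *\<^sub>R g y)"
    unfolding padic_haar_distr[OF haar \<open>surj \<phi>\<close> sim] using p1 g by (intro integral_density) auto
  also have "\<dots> = of_real (real CARD('p) powi \<gamma>) * (LINT y|\<mu>. g y)"
    by (simp add: scaleR_conv_of_real)
  finally show ?thesis using p1 by (simp add: power_int_minus field_simps flip: of_real_mult)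
qed

section \<open>Minimal balls and ball-morphisms\<close>

definition is_padic_sup :: "'p::prime_card padic \<Rightarrow> 'p padic \<Rightarrow> 'p padic set \<Rightarrow> bool" where
  "is_padic_sup x y B \<longleftrightarrow> B \<in> padic_balls \<and> x \<in> B \<and> y \<in> B \<and>
     (\<forall>B'\<in>padic_balls. x \<in> B' \<and> y \<in> B' \<longrightarrow> B \<subseteq> B')"

lemma padic_sup_eqI: "is_padic_sup x y B \<Longrightarrow> padic_sup x y = B"
  unfolding padic_sup_def is_padic_sup_def by (rule the_equality) blast+

text \<open>
  Powers of \<open>p\<close> tend to zero and to infinity, so there is a least exponent \<open>k\<close> whose power bounds
  the distance of the two points. The ball of that radius about \<open>x\<close> is minimal, because a
  ball containing both points has a radius that bounds their distance.
\<close>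

lemma is_padic_sup_exists:
  fixes x y :: "'p::prime_card padic"
  assumes "x \<noteq> y"
  shows "\<exists>B. is_padic_sup x y B"
proof -
  have p1: "real CARD('p) > 1" using prime_gt_1_nat[OF prime_card] by simp
  obtain m :: int where m: "real CARD('p) powi m < dist x y"
    using padic_powi_small[of "dist x y"] assms by auto
  obtain n where n: "dist x y < real CARD('p) powi int n"
    using real_arch_pow[OF p1, of "dist x y"] by auto
  have less: "k < l" if "real CARD('p) powi k < real CARD('p) powi l" for k l
    using that p1 power_int_increasing[of l k "real CARD('p)"] by (meson less_imp_le not_less)
  \<comment> \<open>The search for the least exponent starts at \<open>m\<close>, so that it runs over the natural numbers.\<close>
  define P where "P j \<longleftrightarrow> dist x y \<le> real CARD('p) powi (m + int j)" for j
  have "P (nat (int n - m))" using n less[of m "int n"] m by (simp add: P_def)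
  define k where "k = m + int (LEAST j. P j)"
  have k: "dist x y \<le> real CARD('p) powi k"
    using LeastI[of P, OF \<open>P _\<close>] by (simp add: P_def k_def)
  have min: "k \<le> l" if "dist x y \<le> real CARD('p) powi l" for l
  proof -
    have "m < l" using less m that by (meson less_le_trans)
    hence "P (nat (l - m))" using that by (simp add: P_def)
    from Least_le[of P, OF this] \<open>m < l\<close> show ?thesis by (simp add: k_def)
  qed
  have "cball x (real CARD('p) powi k) \<subseteq> cball a (real CARD('p) powi l)"
    if "x \<in> cball a (real CARD('p) powi l)" "y \<in> cball a (real CARD('p) powi l)" for a l
  proof (rule padic_cball_subset[of _ _ x])
    have "dist x y \<le> real CARD('p) powi l"
      using that padic_dist_ultrametric[of x y a] by (simp add: dist_commute)
    thus "real CARD('p) powi k \<le> real CARD('p) powi l"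
      using min p1 by (intro power_int_increasing) auto
  qed (use that p1 in auto)
  hence "\<forall>B'\<in>padic_balls. x \<in> B' \<and> y \<in> B' \<longrightarrow> cball x (real CARD('p) powi k) \<subseteq> B'"
    unfolding padic_balls_eq_cball by blast
  moreover have "cball x (real CARD('p) powi k) \<in> padic_balls"
    unfolding padic_balls_eq_cball by blast
  ultimately have "is_padic_sup x y (cball x (real CARD('p) powi k))"
    unfolding is_padic_sup_def using k p1 by simp
  thus ?thesis by blast
qed

text \<open>
  The minimal ball is characterized by membership and inclusion among balls alone, and a
  ball-morphism is a bijection that preserves these relations in both directions.
\<close>

lemma padic_sup_ball_morphism:
  assumes \<phi>: "ball_morphism \<phi>" and "x \<noteq> y"
  shows "padic_sup (\<phi> x) (\<phi> y) = \<phi> ` padic_sup x y"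
proof -
  obtain B where B: "is_padic_sup x y B" using is_padic_sup_exists[OF \<open>x \<noteq> y\<close>] by blast
  have "is_padic_sup (\<phi> x) (\<phi> y) (\<phi> ` B)"
    unfolding is_padic_sup_def
  proof (intro conjI ballI impI)
    show "\<phi> ` B \<in> padic_balls" "\<phi> x \<in> \<phi> ` B" "\<phi> y \<in> \<phi> ` B"
      using \<phi> B by (auto simp: ball_morphism_def is_padic_sup_def)
    fix C assume C: "C \<in> padic_balls" "\<phi> x \<in> C \<and> \<phi> y \<in> C"
    hence "\<phi> -` C \<in> padic_balls" using \<phi> by (simp add: ball_morphism_def)
    hence "B \<subseteq> \<phi> -` C" using B C by (simp add: is_padic_sup_def)
    thus "\<phi> ` B \<subseteq> C" by blast
  qed
  thus ?thesis using padic_sup_eqI B by metis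
qed

text \<open>
  On the diagonal \<open>padic_sup\<close> is unspecified, but there both difference factors vanish.
\<close>

lemma padic_D_integrand_ball_morphism:
  assumes "ball_morphism \<phi>"
  shows "padic_D_integrand F f (\<phi> x) (\<phi> y) = padic_D_integrand (\<lambda>I. F (\<phi> ` I)) (f \<circ> \<phi>) x y"
  using padic_sup_ball_morphism[OF assms, of x y] by (cases "x = y") (simp_all add: padic_D_integrand_def)

theorem mainTheorem2:
  fixes \<mu> :: "'p::prime_card padic measure"
    and F :: "'p padic set \<Rightarrow> complex"
    and \<phi> \<psi> :: "'p padic \<Rightarrow> 'p padic"
    and \<gamma> :: int
    and f :: "'p padic \<Rightarrow> complex"
    and x :: "'p padic"
  assumes "padic_haar \<mu>"
    and "ball_morphism \<phi>"
    and "padic_isometry \<psi>"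
    and "\<phi> = (\<lambda>z. of_nat CARD('p) powi \<gamma> * z) \<circ> \<psi>"
    and "integrable \<mu> (padic_D_integrand F f (\<phi> x))"
    and "integrable \<mu> (padic_D_integrand (\<lambda>I. F (\<phi> ` I)) (f \<circ> \<phi>) x)"
  shows "padic_D \<mu> F f (\<phi> x) =
    of_real (of_nat CARD('p) powi (- \<gamma>)) * padic_D \<mu> (\<lambda>I. F (\<phi> ` I)) (f \<circ> \<phi>) x"
proof -
  have "surj \<phi>" using assms(2) by (simp add: ball_morphism_def bij_is_surj)
  moreover have "dist (\<phi> u) (\<phi> v) = real CARD('p) powi (- \<gamma>) * dist u v" for u v
  proof -
    have "\<phi> u - \<phi> v = of_nat CARD('p) powi \<gamma> * (\<psi> u - \<psi> v)"
      by (simp add: assms(4) right_diff_distrib)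
    thus ?thesis
      using assms(3) by (simp add: dist_padic_def padic_norm_mult padic_norm_prime_powi padic_isometry_def)
  qed
  moreover have "padic_D_integrand F f (\<phi> x) \<in> borel_measurable \<mu>"
    using assms(5) by (rule borel_measurable_integrable)
  ultimately show ?thesis
    unfolding padic_D_def padic_D_integrand_ball_morphism[OF assms(2), symmetric]
    by (rule padic_haar_integral_similarity[OF assms(1)])
qed

end
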